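(* Let $M\in\mathbb N$, let $w_1,x_1,w_2,x_2,\ldots,w_M,x_M\in\mathbb C$, and let $\mathbf x=(x_1,x_2,\ldots,x_M)^t\in\mathbb C^M$ (a column vector). Then there exists $f$ in the Fock space $\mathcal F$ such that $$f(w_m)=x_m,\quad m=1,\ldots,M,\qquad\text{and}\qquad\|f\|_{\mathcal F}\le 1$$ if and only if $$\left(e^{w_j\overline{w_k}}\right)_{j,k=1,\ldots,M}\ge\mathbf x\mathbf x^*.$$
   Context: The Fock space $\mathcal F$ is the reproducing kernel Hilbert space of entire functions on $\mathbb C$ with reproducing kernel $K(z,w)=e^{z\overline w}$; equivalently, it is the space of power series $f(z)=\sum_{n=0}^\infty f_nz^n$ with $\|f\|_{\mathcal F}^2=\sum_{n=0}^\infty n!\,|f_n|^2<\infty$. For Hermitian matrices, $A\ge B$ means that $A-B$ is positive semidefinite, and $\mathbf x^*$ is the conjugate transpose of $\mathbf x$. *)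

theory Defs
  imports "HOL-Complex_Analysis.Complex_Analysis"
begin

text \<open>
  The Fock space, as a set of entire functions. The coefficient \<open>f\<^sub>n\<close> of the power series of
  \<open>f\<close> is \<open>fps_nth (fps_expansion f 0) n\<close>, i.e. the \<open>n\<close>-th derivative of \<open>f\<close> at \<open>0\<close> divided by \<open>n!\<close>.
\<close>

definition fock_space :: "(complex \<Rightarrow> complex) set" where
  "fock_space = {f. f holomorphic_on UNIV \<and>
     summable (\<lambda>n. fact n * (norm (fps_nth (fps_expansion f 0) n))\<^sup>2)}"

text \<open>Only meaningful for members of \<^const>\<open>fock_space\<close>, since otherwise the series need not converge.\<close>

definition fock_norm :: "(complex \<Rightarrow> complex) \<Rightarrow> real" where
  "fock_norm f = sqrt (\<Sum>n. fact n * (norm (fps_nth (fps_expansion f 0) n))\<^sup>2)"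

definition conj_transpose :: "complex ^ 'n ^ 'm \<Rightarrow> complex ^ 'm ^ 'n" where
  "conj_transpose A = (\<chi> i j. cnj (A $ j $ i))"

definition hermitian :: "complex ^ 'n ^ 'n \<Rightarrow> bool" where
  "hermitian A \<longleftrightarrow> conj_transpose A = A"

text \<open>For Hermitian \<open>A\<close> the form \<open>v\<^sup>* A v\<close> is real, so that only its real part is constrained.\<close>

definition pos_semidef :: "complex ^ 'n ^ 'n \<Rightarrow> bool" where
  "pos_semidef A \<longleftrightarrow> hermitian A \<and> (\<forall>v. 0 \<le> Re (\<Sum>i\<in>UNIV. cnj (v $ i) * (A *v v) $ i))"

definition loewner_ge :: "complex ^ 'n ^ 'n \<Rightarrow> complex ^ 'n ^ 'n \<Rightarrow> bool" where
  "loewner_ge A B \<longleftrightarrow> hermitian A \<and> hermitian B \<and> pos_semidef (A - B)"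

end

theory Submission
  imports Defs
begin

text \<open>
  Write \<open>G\<close> for the Gram matrix with entries \<open>exp (w\<^sub>j * cnj w\<^sub>k)\<close>. For a vector \<open>v\<close> let
  \<open>F\<^sub>v\<close> be the combination of the reproducing kernels at the nodes with coefficients \<open>v\<close>; its
  values at the nodes are the entries of \<open>G v\<close>. The reproducing property says that the Fock inner
  product of \<open>f\<close> with \<open>F\<^sub>v\<close> is \<open>\<Sum>k. cnj v\<^sub>k * f (w\<^sub>k)\<close>. Applied to \<open>f = F\<^sub>v\<close> it gives
  \<open>\<parallel>F\<^sub>v\<parallel>\<^sup>2 = v\<^sup>* G v\<close>, and the matrix inequality says precisely that
  \<open>\<bar>v\<^sup>* x\<bar>\<^sup>2 \<le> \<parallel>F\<^sub>v\<parallel>\<^sup>2\<close> for every \<open>v\<close>.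

  If \<open>f\<close> interpolates and has norm at most one, then \<open>v\<^sup>* x\<close> is the inner product of \<open>f\<close> with
  \<open>F\<^sub>v\<close>, and the inequality is the one of Cauchy and Schwarz.

  Conversely, the inequality forces \<open>x\<close> to be orthogonal to the kernel of the Hermitian matrix
  \<open>G\<close>, hence to lie in its range, even when nodes coincide and \<open>G\<close> is singular. If \<open>G v = x\<close>, then
  \<open>F\<^sub>v\<close> interpolates, and the inequality for this very \<open>v\<close> reads
  \<open>\<parallel>F\<^sub>v\<parallel>\<^sup>4 \<le> \<parallel>F\<^sub>v\<parallel>\<^sup>2\<close>, so the norm of \<open>F\<^sub>v\<close> is at most one.
\<close>

section \<open>Combinations of reproducing kernels\<close>

definition kernel_comb :: "complex ^ 'm \<Rightarrow> complex ^ 'm \<Rightarrow> complex \<Rightarrow> complex" where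
  "kernel_comb w v z = (\<Sum>k\<in>UNIV. v $ k * exp (z * cnj (w $ k)))"

lemma kernel_comb_holomorphic: "kernel_comb w v holomorphic_on UNIV"
  unfolding kernel_comb_def by (intro holomorphic_intros)

lemma kernel_comb_coeff:
  "fps_nth (fps_expansion (kernel_comb w v) 0) n = (\<Sum>k\<in>UNIV. v $ k * cnj (w $ k) ^ n) / fact n"
proof -
  have "kernel_comb w v has_fps_expansion (\<Sum>k\<in>UNIV. fps_const (v $ k) * fps_exp (cnj (w $ k)))"
    unfolding kernel_comb_def
    by (subst mult.commute[where b = "cnj _"]) (intro fps_expansion_intros)
  then have "fps_expansion (kernel_comb w v) 0 = (\<Sum>k\<in>UNIV. fps_const (v $ k) * fps_exp (cnj (w $ k)))"
    by (rule fps_expansion_eqI)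
  then show ?thesis
    by (simp add: fps_sum_nth sum_divide_distrib)
qed

lemma entire_power_series_sums:
  assumes "f holomorphic_on UNIV"
  shows "(\<lambda>n. fps_nth (fps_expansion f 0) n * z ^ n) sums f z"
  using holomorphic_power_series[of f 0 "norm z + 1" z] holomorphic_on_subset[OF assms]
  by (simp add: fps_expansion_def)

text \<open>
  The weight \<open>n!\<close> cancels the \<open>n!\<close> in the denominators of the kernel coefficients, so that the
  inner product collapses to a combination of power series evaluated at the nodes.
\<close>
lemma kernel_comb_reproducing:
  assumes "f holomorphic_on UNIV"
  shows "(\<lambda>n. fact n * (fps_nth (fps_expansion f 0) n * cnj (fps_nth (fps_expansion (kernel_comb w v) 0) n)))
           sums (\<Sum>k\<in>UNIV. cnj (v $ k) * f (w $ k))"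
proof -
  have "(\<lambda>n. \<Sum>k\<in>UNIV. cnj (v $ k) * (fps_nth (fps_expansion f 0) n * (w $ k) ^ n))
          sums (\<Sum>k\<in>UNIV. cnj (v $ k) * f (w $ k))"
    by (intro sums_sum sums_mult entire_power_series_sums assms)
  also have "(\<lambda>n. \<Sum>k\<in>UNIV. cnj (v $ k) * (fps_nth (fps_expansion f 0) n * (w $ k) ^ n)) =
    (\<lambda>n. fact n * (fps_nth (fps_expansion f 0) n * cnj (fps_nth (fps_expansion (kernel_comb w v) 0) n)))"
    by (rule ext) (simp add: kernel_comb_coeff sum_distrib_left sum_divide_distrib mult_ac)
  finally show ?thesis .
qed

definition gram_form :: "complex ^ 'm \<Rightarrow> complex ^ 'm \<Rightarrow> real" where
  "gram_form w v = Re (\<Sum>k\<in>UNIV. cnj (v $ k) * kernel_comb w v (w $ k))"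

lemma kernel_comb_norm_sums:
  "(\<lambda>n. fact n * (norm (fps_nth (fps_expansion (kernel_comb w v) 0) n))\<^sup>2) sums gram_form w v"
proof -
  have "(\<lambda>n. Re (fact n * (fps_nth (fps_expansion (kernel_comb w v) 0) n *
          cnj (fps_nth (fps_expansion (kernel_comb w v) 0) n)))) sums gram_form w v"
    unfolding gram_form_def
    by (rule sums_Re[OF kernel_comb_reproducing[OF kernel_comb_holomorphic]])
  moreover have "Re (fact n * (c * cnj c)) = fact n * (norm c)\<^sup>2" for n and c :: complex
    unfolding of_real_fact[where 'a = complex, symmetric]
    by (simp only: Re_complex_of_real complex_norm_square[symmetric] of_real_mult[symmetric])
  ultimately show ?thesis by simp
qed

lemma kernel_comb_in_fock_space: "kernel_comb w v \<in> fock_space"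
  using kernel_comb_norm_sums[of w v] kernel_comb_holomorphic[of w v]
  by (auto simp: fock_space_def sums_iff)

lemma fock_norm_kernel_comb: "fock_norm (kernel_comb w v) = sqrt (gram_form w v)"
  using kernel_comb_norm_sums[of w v] by (simp add: fock_norm_def sums_iff)

section \<open>The Cauchy--Schwarz inequality\<close>

lemma l2_Cauchy_Schwarz_sums:
  fixes a b :: "nat \<Rightarrow> complex"
  assumes "(\<lambda>n. (norm (a n))\<^sup>2) sums A" "(\<lambda>n. (norm (b n))\<^sup>2) sums B" "(\<lambda>n. a n * b n) sums S"
  shows "norm S \<le> sqrt A * sqrt B"
proof -
  have "norm (\<Sum>n<N. a n * b n) \<le> sqrt A * sqrt B" for N
  proof -
    have "norm (\<Sum>n<N. a n * b n) \<le> (\<Sum>n<N. \<bar>norm (a n)\<bar> * \<bar>norm (b n)\<bar>)"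
      by (rule sum_norm_le) (simp add: norm_mult)
    also have "\<dots> \<le> L2_set (\<lambda>n. norm (a n)) {..<N} * L2_set (\<lambda>n. norm (b n)) {..<N}"
      by (rule L2_set_mult_ineq)
    also have "\<dots> \<le> sqrt A * sqrt B"
      unfolding L2_set_def
      using sum_le_suminf[of "\<lambda>n. (norm (a n))\<^sup>2" "{..<N}"] sum_le_suminf[of "\<lambda>n. (norm (b n))\<^sup>2" "{..<N}"]
        assms(1,2) by (intro mult_mono) (auto simp: sums_iff sum_nonneg suminf_nonneg)
    finally show ?thesis .
  qed
  moreover have "(\<lambda>N. norm (\<Sum>n<N. a n * b n)) \<longlonglongrightarrow> norm S"
    using assms(3) unfolding sums_def by (rule tendsto_norm)
  ultimately show ?thesis
    by (intro LIMSEQ_le_const2[where X = "\<lambda>N. norm (\<Sum>n<N. a n * b n)"]) auto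
qed

lemma fock_Cauchy_Schwarz:
  assumes "f \<in> fock_space"
  shows "norm (\<Sum>k\<in>UNIV. cnj (v $ k) * f (w $ k)) \<le> fock_norm f * sqrt (gram_form w v)"
proof -
  define c where "c = fps_nth (fps_expansion f 0)"
  define d where "d = fps_nth (fps_expansion (kernel_comb w v) 0)"
  \<comment> \<open>Scaling by \<open>sqrt (n!)\<close> carries the weighted sequence space to the unweighted one.\<close>
  define s :: "nat \<Rightarrow> real" where "s = (\<lambda>n. sqrt (fact n))"
  have s2: "(s n)\<^sup>2 = fact n" for n
    by (simp add: s_def)
  have ss: "complex_of_real (s n) * (complex_of_real (s n) * z) = fact n * z" for n z
    using arg_cong[OF s2[of n], of complex_of_real] by (simp add: power2_eq_square mult.assoc[symmetric])
  have hol: "f holomorphic_on UNIV" and sm: "summable (\<lambda>n. fact n * (norm (c n))\<^sup>2)"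
    using assms by (auto simp: fock_space_def c_def)
  have "(\<lambda>n. (norm (of_real (s n) * c n))\<^sup>2) sums (\<Sum>n. fact n * (norm (c n))\<^sup>2)"
    using summable_sums[OF sm] by (simp add: norm_mult power_mult_distrib s2)
  moreover have "(\<lambda>n. (norm (of_real (s n) * cnj (d n)))\<^sup>2) sums gram_form w v"
    using kernel_comb_norm_sums[of w v] by (simp add: norm_mult power_mult_distrib s2 d_def)
  moreover have "(\<lambda>n. (of_real (s n) * c n) * (of_real (s n) * cnj (d n)))
      sums (\<Sum>k\<in>UNIV. cnj (v $ k) * f (w $ k))"
    using kernel_comb_reproducing[OF hol, of w v] by (simp add: c_def d_def mult_ac ss)
  ultimately show ?thesis
    unfolding fock_norm_def c_def[symmetric] by (rule l2_Cauchy_Schwarz_sums)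
qed

section \<open>Ranges of Hermitian matrices\<close>

lemma inner_vec_complex: "u \<bullet> v = Re (\<Sum>i\<in>UNIV. cnj (u $ i) * v $ i)" for u v :: "complex ^ 'm"
  by (simp add: inner_vec_def inner_complex_def Re_sum)

lemma hermitian_inner:
  assumes "hermitian A"
  shows "(A *v u) \<bullet> v = u \<bullet> (A *v v)"
proof -
  have h: "cnj (A $ i $ j) = A $ j $ i" for i j
    using assms by (auto simp: hermitian_def conj_transpose_def vec_eq_iff)
  have "(\<Sum>i\<in>UNIV. cnj ((A *v u) $ i) * v $ i) = (\<Sum>i\<in>UNIV. \<Sum>j\<in>UNIV. A $ j $ i * cnj (u $ j) * v $ i)"
    by (simp add: matrix_vector_mult_def sum_distrib_right h)
  also have "\<dots> = (\<Sum>j\<in>UNIV. \<Sum>i\<in>UNIV. A $ j $ i * cnj (u $ j) * v $ i)"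
    by (rule sum.swap)
  also have "\<dots> = (\<Sum>j\<in>UNIV. cnj (u $ j) * (A *v v) $ j)"
    by (simp add: matrix_vector_mult_def sum_distrib_left mult_ac)
  finally show ?thesis
    by (simp add: inner_vec_complex)
qed

text \<open>
  The component of \<open>x\<close> orthogonal to the range of a Hermitian matrix lies in its kernel; the
  quadratic form vanishes there, so the bound makes \<open>x\<close> orthogonal to that component, which is
  therefore zero. Orthogonality for the underlying real inner product suffices.
\<close>
lemma bounded_functional_in_range:
  fixes A :: "complex ^ 'm ^ 'm"
  assumes herm: "hermitian A"
    and bound: "\<And>v. (norm (\<Sum>i\<in>UNIV. cnj (v $ i) * x $ i))\<^sup>2 \<le> v \<bullet> (A *v v)"
  shows "\<exists>v. A *v v = x"
proof -
  have lin: "linear ((*v) A)"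
    by (rule linearI)
      (simp_all add: vec_eq_iff matrix_vector_mult_def scaleR_sum_right distrib_left sum.distrib)
  then have span: "span (range ((*v) A)) = range ((*v) A)"
    by (intro span_eq_iff[THEN iffD2] linear_subspace_image subspace_UNIV)
  obtain y z where yz: "y \<in> span (range ((*v) A))" "\<And>u. u \<in> span (range ((*v) A)) \<Longrightarrow> orthogonal z u"
    "x = y + z"
    by (rule orthogonal_subspace_decomp_exists) blast
  have "(A *v z) \<bullet> (A *v z) = z \<bullet> (A *v (A *v z))"
    by (rule hermitian_inner[OF herm])
  also have "\<dots> = 0"
    using yz(2)[of "A *v (A *v z)"] by (simp add: span orthogonal_def)
  finally have "A *v z = 0" by simp
  then have "z \<bullet> x = 0"
    using bound[of z] by (simp add: inner_vec_complex)
  moreover have "z \<bullet> y = 0"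
    using yz(1,2) by (auto simp: orthogonal_def)
  ultimately have "z = 0"
    using yz(3) by (simp add: inner_add_right)
  then show ?thesis
    using yz(1,3) by (auto simp: span)
qed

section \<open>The matrix inequality as a family of scalar bounds\<close>

definition kernel_gram :: "complex ^ 'm \<Rightarrow> complex ^ 'm ^ 'm" where
  "kernel_gram w = (\<chi> j k. exp (w $ j * cnj (w $ k)))"

lemma hermitian_kernel_gram: "hermitian (kernel_gram w)"
  by (simp add: hermitian_def conj_transpose_def kernel_gram_def vec_eq_iff exp_cnj mult.commute)

lemma kernel_gram_mult_nth: "(kernel_gram w *v v) $ j = kernel_comb w v (w $ j)"
  by (simp add: kernel_gram_def kernel_comb_def matrix_vector_mult_def mult.commute)

lemma inner_kernel_gram: "v \<bullet> (kernel_gram w *v v) = gram_form w v"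
  by (simp add: inner_vec_complex gram_form_def kernel_gram_mult_nth)

lemma rank_one_nth:
  fixes x :: "complex ^ 'm"
  shows "((columnvector x :: complex ^ 1 ^ 'm) ** conj_transpose (columnvector x)) $ i $ j = x $ i * cnj (x $ j)"
  by (simp add: matrix_matrix_mult_def conj_transpose_def columnvector_def)

lemma hermitian_rank_one:
  fixes x :: "complex ^ 'm"
  shows "hermitian ((columnvector x :: complex ^ 1 ^ 'm) ** conj_transpose (columnvector x))"
  by (simp add: hermitian_def conj_transpose_def[of "_ ** _"] vec_eq_iff rank_one_nth mult.commute)

lemma inner_rank_one:
  fixes x v :: "complex ^ 'm"
  shows "v \<bullet> (((columnvector x :: complex ^ 1 ^ 'm) ** conj_transpose (columnvector x)) *v v) =
    (norm (\<Sum>i\<in>UNIV. cnj (v $ i) * x $ i))\<^sup>2"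
proof -
  let ?s = "\<Sum>i\<in>UNIV. cnj (v $ i) * x $ i"
  have "(((columnvector x :: complex ^ 1 ^ 'm) ** conj_transpose (columnvector x)) *v v) $ i = x $ i * cnj ?s" for i
    by (simp add: matrix_vector_mult_def rank_one_nth sum_distrib_left mult_ac)
  then have "v \<bullet> (((columnvector x :: complex ^ 1 ^ 'm) ** conj_transpose (columnvector x)) *v v) = Re (?s * cnj ?s)"
    by (simp only: inner_vec_complex sum_distrib_right mult.assoc)
  then show ?thesis
    by (simp only: complex_norm_square[symmetric] Re_complex_of_real)
qed

lemma loewner_kernel_gram_iff:
  fixes w x :: "complex ^ 'm"
  shows "loewner_ge (kernel_gram w) ((columnvector x :: complex ^ 1 ^ 'm) ** conj_transpose (columnvector x))
    \<longleftrightarrow> (\<forall>v. (norm (\<Sum>i\<in>UNIV. cnj (v $ i) * x $ i))\<^sup>2 \<le> gram_form w v)"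
proof -
  have diff: "hermitian (A - B)" if "hermitian A" "hermitian B" for A B :: "complex ^ 'm ^ 'm"
    using that by (simp add: hermitian_def conj_transpose_def vec_eq_iff)
  show ?thesis
    unfolding loewner_ge_def pos_semidef_def inner_vec_complex[symmetric]
      matrix_vector_mult_diff_rdistrib inner_diff_right inner_kernel_gram inner_rank_one
    by (simp add: hermitian_kernel_gram hermitian_rank_one diff)
qed

section \<open>The interpolation criterion\<close>

theorem theorem3p3:
  fixes w x :: "complex ^ 'm"
  shows "(\<exists>f \<in> fock_space. (\<forall>m. f (w $ m) = x $ m) \<and> fock_norm f \<le> 1) \<longleftrightarrow>
    loewner_ge (\<chi> j k. exp (w $ j * cnj (w $ k)))
      ((columnvector x :: complex ^ 1 ^ 'm) ** conj_transpose (columnvector x))"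
proof -
  have form_nonneg: "0 \<le> gram_form w v" for v
    by (rule sums_le[OF _ sums_zero kernel_comb_norm_sums]) simp
  have "(\<exists>f \<in> fock_space. (\<forall>m. f (w $ m) = x $ m) \<and> fock_norm f \<le> 1) \<longleftrightarrow>
    (\<forall>v. (norm (\<Sum>i\<in>UNIV. cnj (v $ i) * x $ i))\<^sup>2 \<le> gram_form w v)"
  proof
    assume "\<exists>f \<in> fock_space. (\<forall>m. f (w $ m) = x $ m) \<and> fock_norm f \<le> 1"
    then obtain f where f: "f \<in> fock_space" "\<And>m. f (w $ m) = x $ m" "fock_norm f \<le> 1"
      by blast
    show "\<forall>v. (norm (\<Sum>i\<in>UNIV. cnj (v $ i) * x $ i))\<^sup>2 \<le> gram_form w v"
    proof
      fix v
      have "norm (\<Sum>i\<in>UNIV. cnj (v $ i) * x $ i) \<le> fock_norm f * sqrt (gram_form w v)"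
        using fock_Cauchy_Schwarz[OF f(1), of v w] by (simp add: f(2))
      also have "\<dots> \<le> sqrt (gram_form w v)"
        using mult_right_mono[OF f(3), of "sqrt (gram_form w v)"] form_nonneg[of v] by simp
      finally show "(norm (\<Sum>i\<in>UNIV. cnj (v $ i) * x $ i))\<^sup>2 \<le> gram_form w v"
        using form_nonneg[of v] power_mono[of "norm (\<Sum>i\<in>UNIV. cnj (v $ i) * x $ i)" _ 2] by fastforce
    qed
  next
    assume bound: "\<forall>v. (norm (\<Sum>i\<in>UNIV. cnj (v $ i) * x $ i))\<^sup>2 \<le> gram_form w v"
    then obtain v where v: "kernel_gram w *v v = x"
      using bounded_functional_in_range[OF hermitian_kernel_gram[of w], of x]
      by (auto simp: inner_kernel_gram)
    have interp: "kernel_comb w v (w $ m) = x $ m" for m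
      using v kernel_gram_mult_nth by metis
    \<comment> \<open>For this \<open>v\<close> the form equals \<open>v\<^sup>* x\<close>, so the bound reads \<open>t\<^sup>2 \<le> t\<close> with \<open>t\<close> the squared norm.\<close>
    have "gram_form w v \<le> norm (\<Sum>i\<in>UNIV. cnj (v $ i) * x $ i)"
      unfolding gram_form_def interp by (rule complex_Re_le_cmod)
    then have "(gram_form w v)\<^sup>2 \<le> (norm (\<Sum>i\<in>UNIV. cnj (v $ i) * x $ i))\<^sup>2"
      using form_nonneg by (rule power_mono)
    also have "\<dots> \<le> gram_form w v"
      using bound by blast
    finally have "gram_form w v \<le> 1"
      by (auto simp: power2_eq_square mult_le_cancel_left2 not_less)
    then have "fock_norm (kernel_comb w v) \<le> 1"
      by (simp add: fock_norm_kernel_comb)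
    then show "\<exists>f \<in> fock_space. (\<forall>m. f (w $ m) = x $ m) \<and> fock_norm f \<le> 1"
      using kernel_comb_in_fock_space interp by blast
  qed
  then show ?thesis
    by (simp only: loewner_kernel_gram_iff[unfolded kernel_gram_def])
qed

end
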